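(* Let $\Theta$ parameterize an uncertainty class $\{(\Xi_\theta,\Lambda_\theta)\}_{\theta\in\Theta}$ of random labeled point processes (RLPPs), $\Lambda_\theta=\{\Phi_{\theta,S}:S\in\mathbf{N}\}$, with prior $\pi(\theta)$. There exists an RLPP $(\Xi_{\mathrm{eff}},\Lambda_{\mathrm{eff}})$, $\Lambda_{\mathrm{eff}}=\{\Phi_{\mathrm{eff},S}:S\in\mathbf{N}\}$, such that $$E_\theta\Big[E_{\Xi_\theta,\Lambda_\theta}\big[g(\Xi_\theta,\Phi_{\theta,\Xi_\theta})\,\big|\,\theta\big]\Big]=E_{\Xi_{\mathrm{eff}},\Lambda_{\mathrm{eff}}}\big[g(\Xi_{\mathrm{eff}},\Phi_{\mathrm{eff},\Xi_{\mathrm{eff}}})\big]$$ for any real-valued measurable function $g$ (of point set and label function pairs).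
   Context: Fix $d\ge1$ and $L=\{1,\dots,l\}$. $\mathbf{N}$ is the family of finite sequences in $\mathbb{R}^d$, whose elements $S$ are treated as finite point sets $S\subset\mathbb{R}^d$; $\eta(S)$ is the number of points in $S$; and $\mathcal{N}$ is the smallest $\sigma$-algebra on $\mathbf{N}$ such that $S\mapsto\eta(S\cap B)$ is measurable for every Borel set $B$ in $\mathbb{R}^d$. A label function on $S\in\mathbf{N}$ is a map $\phi_S:S\to L$. A random labeled point process (RLPP) is a pair $(\Xi,\Lambda)$, where $\Xi$ is a point process, i.e. a measurable map from a probability space to $(\mathbf{N},\mathcal{N})$, generating a point set $S$, and $\Lambda=\{\Phi_S:S\in\mathbf{N}\}$ is a random labeling: for each $S$, $\Phi_S$ is a random label function with probability mass function $P(\Phi_S=\phi_S\mid S)$ on $L^S$. The pair $(\Xi,\Phi_\Xi)$ is generated by drawing a point set $S$ from $\Xi$ and then a label function on $S$ from $P(\Phi_S=\cdot\mid S)$; $E_{\Xi,\Lambda}$ is expectation over this draw. In the uncertainty class, for each state $\theta\in\Theta$, $\Xi_\theta$ is a point process on $(\mathbf{N},\mathcal{N})$ and $\Lambda_\theta=\{\Phi_{\theta,S}:S\in\mathbf{N}\}$ is a random labeling consisting of a random label function $\Phi_{\theta,S}$ for each $S$. The state $\theta$ is random with prior $\pi(\theta)$, and $E_\theta$ denotes expectation over $\theta$ with respect to $\pi$. *)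

theory Defs
  imports "HOL-Probability.Probability"
begin

text \<open>The measurable space of finite point sets: the smallest \<sigma>-algebra for which the point
  count of every Borel set is measurable.\<close>

definition point_sets :: "(real ^ 'd) set measure" where
  "point_sets = sigma {S. finite S}
     {{S. finite S \<and> card (S \<inter> B) \<in> A} | A B. B \<in> sets borel}"

text \<open>Label functions on \<open>S\<close> are represented by the extensional functions, i.e. they
  are \<open>undefined\<close> off \<open>S\<close>, so that the elements of this set correspond one-to-one to the maps
  from \<open>S\<close> to \<open>{1..l}\<close>.\<close>

definition label_functions :: "nat \<Rightarrow> 'a set \<Rightarrow> ('a \<Rightarrow> nat) set" where
  "label_functions l S = S \<rightarrow>\<^sub>E {1..l}"

text \<open>The pairs of a finite point set and a label function on it. The \<sigma>-algebra is the usual one for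
  finite marked point configurations: the smallest one for which, for every Borel set \<open>B\<close> and every
  label \<open>y\<close>, the number of points in \<open>B\<close> with label \<open>y\<close> is measurable.\<close>

definition labeled_point_sets :: "nat \<Rightarrow> ((real ^ 'd) set \<times> (real ^ 'd \<Rightarrow> nat)) measure" where
  "labeled_point_sets l = sigma {(S, \<phi>). finite S \<and> \<phi> \<in> label_functions l S}
     {{(S, \<phi>). finite S \<and> \<phi> \<in> label_functions l S \<and> card {x \<in> S \<inter> B. \<phi> x = y} \<in> A}
       | A B y. B \<in> sets borel \<and> y \<in> {1..l}}"

definition point_process :: "'w measure \<Rightarrow> ('w \<Rightarrow> (real ^ 'd) set) \<Rightarrow> bool" where
  "point_process P \<Xi> \<longleftrightarrow> prob_space P \<and> \<Xi> \<in> P \<rightarrow>\<^sub>M point_sets"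

text \<open>A family of random label functions is given by the probability mass functions
  \<open>\<Lambda> S\<close> of its members, for finite \<open>S\<close>. The distribution of the pair of \<open>S\<close> and its random label
  function, for fixed \<open>S\<close>:\<close>

definition label_law ::
  "nat \<Rightarrow> ((real ^ 'd) set \<Rightarrow> (real ^ 'd \<Rightarrow> nat) pmf) \<Rightarrow> (real ^ 'd) set \<Rightarrow>
   ((real ^ 'd) set \<times> (real ^ 'd \<Rightarrow> nat)) measure" where
  "label_law l \<Lambda> S =
     distr (point_measure (label_functions l S) (\<lambda>\<phi>. ennreal (pmf (\<Lambda> S) \<phi>)))
       (labeled_point_sets l) (\<lambda>\<phi>. (S, \<phi>))"

text \<open>The second conjunct makes \<open>label_law l \<Lambda>\<close> a Markov kernel. Without it, drawing a point set
  and then a label function on it would not define a distribution on pairs.\<close>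

definition random_labeling ::
  "nat \<Rightarrow> ((real ^ 'd) set \<Rightarrow> (real ^ 'd \<Rightarrow> nat) pmf) \<Rightarrow> bool" where
  "random_labeling l \<Lambda> \<longleftrightarrow>
     (\<forall>S. finite S \<longrightarrow> set_pmf (\<Lambda> S) \<subseteq> label_functions l S) \<and>
     label_law l \<Lambda> \<in> point_sets \<rightarrow>\<^sub>M prob_algebra (labeled_point_sets l)"

definition rlpp ::
  "nat \<Rightarrow> 'w measure \<Rightarrow> ('w \<Rightarrow> (real ^ 'd) set) \<Rightarrow>
   ((real ^ 'd) set \<Rightarrow> (real ^ 'd \<Rightarrow> nat) pmf) \<Rightarrow> bool" where
  "rlpp l P \<Xi> \<Lambda> \<longleftrightarrow> point_process P \<Xi> \<and> random_labeling l \<Lambda>"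

text \<open>The distribution of the pair obtained by drawing a point set from the point
  process and then a label function on it. Expectations of functions of such pairs are integrals with
  respect to this measure.\<close>

definition rlpp_law ::
  "nat \<Rightarrow> 'w measure \<Rightarrow> ('w \<Rightarrow> (real ^ 'd) set) \<Rightarrow>
   ((real ^ 'd) set \<Rightarrow> (real ^ 'd \<Rightarrow> nat) pmf) \<Rightarrow>
   ((real ^ 'd) set \<times> (real ^ 'd \<Rightarrow> nat)) measure" where
  "rlpp_law l P \<Xi> \<Lambda> = distr P point_sets \<Xi> \<bind> label_law l \<Lambda>"

end

theory Submission imports Defs begin

text \<open>Mix the laws of the labeled processes over the prior to a single law \<open>Q\<close> of labeled point
  sets and let \<open>\<Xi>_eff\<close> be its point set marginal; what has to be found is a disintegration of \<open>Q\<close>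
  along the projection to the point set. Labeling the marginal uniformly gives a law \<open>U\<close> that
  charges every labeling of almost every point set, so \<open>Q\<close> is absolutely continuous with respect to
  \<open>U\<close>, and its density, restricted to a point set, is the effective labeling relative to the uniform
  one. It is normalized for almost every point set; on the exceptional ones the uniform labeling is
  kept.\<close>

section \<open>Label functions and the generators of the two \<sigma>-algebras\<close>

lemma finite_label_functions: "finite S \<Longrightarrow> finite (label_functions l S)"
  by (simp add: label_functions_def finite_PiE)

lemma label_functions_nonempty: "1 \<le> l \<Longrightarrow> label_functions l S \<noteq> {}"
  by (auto simp: label_functions_def PiE_eq_empty_iff)

lemma space_point_sets: "space (point_sets :: (real ^ 'd) set measure) = {S. finite S}"
  unfolding point_sets_def by (rule space_measure_of) auto

lemma sets_point_sets:
  "sets (point_sets :: (real ^ 'd) set measure) =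
    sigma_sets {S. finite S} {{S. finite S \<and> card (S \<inter> B) \<in> A} | A B. B \<in> sets borel}"
  unfolding point_sets_def by (rule sets_measure_of) auto

lemma space_labeled_point_sets:
  "space (labeled_point_sets l :: ((real ^ 'd) set \<times> _) measure) =
    {(S, \<phi>). finite S \<and> \<phi> \<in> label_functions l S}"
  unfolding labeled_point_sets_def by (rule space_measure_of) auto

lemma sets_labeled_point_sets:
  "sets (labeled_point_sets l :: ((real ^ 'd) set \<times> _) measure) =
    sigma_sets {(S, \<phi>). finite S \<and> \<phi> \<in> label_functions l S}
     {{(S, \<phi>). finite S \<and> \<phi> \<in> label_functions l S \<and> card {x \<in> S \<inter> B. \<phi> x = y} \<in> A}
       | A B y. B \<in> sets borel \<and> y \<in> {1..l}}"
  unfolding labeled_point_sets_def by (rule sets_measure_of) auto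

lemma measurable_card_Int:
  assumes "B \<in> sets borel"
  shows "(\<lambda>S. card (S \<inter> B)) \<in> (point_sets :: (real ^ 'd) set measure) \<rightarrow>\<^sub>M count_space UNIV"
proof (rule measurableI)
  fix A :: "nat set"
  have "{S :: (real ^ 'd) set. finite S \<and> card (S \<inter> B) \<in> A} \<in> sets point_sets"
    unfolding sets_point_sets using assms by (intro sigma_sets.Basic) auto
  then show "(\<lambda>S. card (S \<inter> B)) -` A \<inter> space point_sets \<in> sets point_sets"
    by (simp add: space_point_sets vimage_def Int_def conj_commute)
qed simp

lemma measurable_card_label:
  fixes B :: "(real ^ 'd) set"
  assumes "B \<in> sets borel" "y \<in> {1..l}"
  shows "(\<lambda>z. card {x \<in> fst z \<inter> B. snd z x = y}) \<in> labeled_point_sets l \<rightarrow>\<^sub>M count_space UNIV"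
proof (rule measurableI)
  fix A :: "nat set"
  have "{(S, \<phi>). finite S \<and> \<phi> \<in> label_functions l S \<and> card {x \<in> S \<inter> B. \<phi> x = y} \<in> A}
      \<in> sets (labeled_point_sets l)"
    unfolding sets_labeled_point_sets using assms by (intro sigma_sets.Basic) blast
  also have "{(S, \<phi>). finite S \<and> \<phi> \<in> label_functions l S \<and> card {x \<in> S \<inter> B. \<phi> x = y} \<in> A} =
      (\<lambda>z. card {x \<in> fst z \<inter> B. snd z x = y}) -` A \<inter> space (labeled_point_sets l)"
    by (auto simp: space_labeled_point_sets)
  finally show "(\<lambda>z. card {x \<in> fst z \<inter> B. snd z x = y}) -` A \<inter> space (labeled_point_sets l)
    \<in> sets (labeled_point_sets l)" .
qed simp

text \<open>Every point carries exactly one label in \<open>{1..l}\<close>, so the point count of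
  \<open>B\<close> is the sum over all labels of the labeled counts of \<open>B\<close>, which are
  measurable.\<close>

lemma measurable_fst_labeled_point_sets:
  "fst \<in> labeled_point_sets l \<rightarrow>\<^sub>M (point_sets :: (real ^ 'd) set measure)"
  unfolding point_sets_def
proof (rule measurable_measure_of)
  show "fst \<in> space (labeled_point_sets l) \<rightarrow> {S :: (real ^ 'd) set. finite S}"
    by (auto simp: space_labeled_point_sets)
  fix Y :: "(real ^ 'd) set set"
  assume "Y \<in> {{S. finite S \<and> card (S \<inter> B) \<in> A} | A B. B \<in> sets borel}"
  then obtain A and B :: "(real ^ 'd) set"
    where Y: "Y = {S. finite S \<and> card (S \<inter> B) \<in> A}" and B: "B \<in> sets borel"
    by blast
  have sum: "card (S \<inter> B) = (\<Sum>y\<in>{1..l}. card {x \<in> S \<inter> B. \<phi> x = y})"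
    if "finite S" "\<phi> \<in> label_functions l S" for S :: "(real ^ 'd) set" and \<phi>
  proof -
    have "S \<inter> B = (\<Union>y\<in>{1..l}. {x \<in> S \<inter> B. \<phi> x = y})"
      using that(2) by (auto simp: label_functions_def PiE_def Pi_def)
    then have "card (S \<inter> B) = card (\<Union>y\<in>{1..l}. {x \<in> S \<inter> B. \<phi> x = y})"
      by (rule arg_cong)
    also have "\<dots> = (\<Sum>y\<in>{1..l}. card {x \<in> S \<inter> B. \<phi> x = y})"
      using that(1) by (intro card_UN_disjoint) auto
    finally show ?thesis .
  qed
  have "(\<lambda>z. \<Sum>y\<in>{1..l}. card {x \<in> fst z \<inter> B. snd z x = y})
      \<in> labeled_point_sets l \<rightarrow>\<^sub>M count_space UNIV"
    by (intro measurable_sum_nat measurable_card_label B)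
  then have "(\<lambda>z. \<Sum>y\<in>{1..l}. card {x \<in> fst z \<inter> B. snd z x = y}) -` A
      \<inter> space (labeled_point_sets l) \<in> sets (labeled_point_sets l)"
    by (rule measurable_sets) simp
  also have "(\<lambda>z. \<Sum>y\<in>{1..l}. card {x \<in> fst z \<inter> B. snd z x = y}) -` A
      \<inter> space (labeled_point_sets l) = fst -` Y \<inter> space (labeled_point_sets l)"
    by (auto simp: space_labeled_point_sets Y sum)
  finally show "fst -` Y \<inter> space (labeled_point_sets l) \<in> sets (labeled_point_sets l)" .
qed auto

section \<open>An intersection-stable generator for the labeled point sets\<close>

text \<open>Each triple in \<open>I\<close> is one constraint of the kind that generates
  \<open>labeled_point_sets\<close>. A set of constraints is used because single ones are not closed
  under intersection; \<open>I = {}\<close> gives back all label functions.\<close>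

definition consistent_labels ::
  "nat \<Rightarrow> ('a set \<times> nat set \<times> nat) set \<Rightarrow> 'a set \<Rightarrow> ('a \<Rightarrow> nat) set" where
  "consistent_labels l I S =
    {\<phi> \<in> label_functions l S. \<forall>(B, A, y)\<in>I. card {x \<in> S \<inter> B. \<phi> x = y} \<in> A}"

definition joint_count_set ::
  "nat \<Rightarrow> ((real ^ 'd) set \<times> nat set \<times> nat) set \<Rightarrow> ((real ^ 'd) set \<times> (real ^ 'd \<Rightarrow> nat)) set" where
  "joint_count_set l I = {(S, \<phi>). finite S \<and> \<phi> \<in> consistent_labels l I S}"

definition joint_count_sets :: "nat \<Rightarrow> ((real ^ 'd) set \<times> (real ^ 'd \<Rightarrow> nat)) set set" where
  "joint_count_sets l = joint_count_set l ` {I. finite I \<and> I \<subseteq> sets borel \<times> UNIV \<times> {1..l}}"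

lemma Int_stable_joint_count_sets:
  "Int_stable (joint_count_sets l :: ((real ^ 'd) set \<times> _) set set)"
proof (rule Int_stableI)
  fix a b :: "((real ^ 'd) set \<times> (real ^ 'd \<Rightarrow> nat)) set"
  assume "a \<in> joint_count_sets l" "b \<in> joint_count_sets l"
  then obtain I J :: "((real ^ 'd) set \<times> nat set \<times> nat) set"
    where I: "finite I" "I \<subseteq> sets borel \<times> UNIV \<times> {1..l}" "a = joint_count_set l I"
      and J: "finite J" "J \<subseteq> sets borel \<times> UNIV \<times> {1..l}" "b = joint_count_set l J"
    unfolding joint_count_sets_def by (elim imageE CollectE conjE)
  have "a \<inter> b = joint_count_set l (I \<union> J)"
    unfolding I(3) J(3) joint_count_set_def consistent_labels_def ball_Un by blast
  then show "a \<inter> b \<in> joint_count_sets l"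
    unfolding joint_count_sets_def by (rule image_eqI) (use I(1,2) J(1,2) in simp)
qed

lemma sets_joint_count_set:
  assumes I: "finite I" "I \<subseteq> sets borel \<times> UNIV \<times> {1..l}"
  shows "joint_count_set l I \<in> sets (labeled_point_sets l :: ((real ^ 'd) set \<times> _) measure)"
proof -
  have "joint_count_set l I = {z \<in> space (labeled_point_sets l).
      \<forall>i\<in>I. card {x \<in> fst z \<inter> fst i. snd z x = snd (snd i)} \<in> fst (snd i)}"
    by (auto simp: joint_count_set_def consistent_labels_def space_labeled_point_sets split_beta)
  also have "\<dots> \<in> sets (labeled_point_sets l)"
  proof (rule sets.sets_Collect_finite_All[OF _ I(1)])
    fix i assume "i \<in> I"
    then have "fst i \<in> sets borel" "snd (snd i) \<in> {1..l}"
      using I(2) by auto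
    from measurable_sets[OF measurable_card_label[OF this], of "fst (snd i)"]
    show "{z \<in> space (labeled_point_sets l).
        card {x \<in> fst z \<inter> fst i. snd z x = snd (snd i)} \<in> fst (snd i)} \<in> sets (labeled_point_sets l)"
      by (simp add: vimage_def Int_def conj_commute)
  qed
  finally show ?thesis .
qed

text \<open>Singletons \<open>I\<close> recover the original generators, and finite conjunctions of
  measurable conditions are measurable. Together with stability under intersection, this allows a
  probability kernel to be checked for measurability on \<open>joint_count_sets\<close>
  alone.\<close>

lemma sets_labeled_point_sets_joint:
  "sets (labeled_point_sets l :: ((real ^ 'd) set \<times> _) measure) =
    sigma_sets {(S, \<phi>). finite S \<and> \<phi> \<in> label_functions l S} (joint_count_sets l)"
proof (rule antisym)
  show "sets (labeled_point_sets l :: ((real ^ 'd) set \<times> _) measure) \<subseteq>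
    sigma_sets {(S, \<phi>). finite S \<and> \<phi> \<in> label_functions l S} (joint_count_sets l)"
    unfolding sets_labeled_point_sets
  proof (rule sigma_sets_mono', rule subsetI, elim CollectE exE conjE)
    fix a A y and B :: "(real ^ 'd) set"
    assume By: "B \<in> sets borel" "y \<in> {1..l}" and a:
      "a = {(S, \<phi>). finite S \<and> \<phi> \<in> label_functions l S \<and> card {x \<in> S \<inter> B. \<phi> x = y} \<in> A}"
    have "a = joint_count_set l {(B, A, y)}"
      unfolding a joint_count_set_def consistent_labels_def by auto
    then show "a \<in> joint_count_sets l"
      unfolding joint_count_sets_def by (rule image_eqI) (use By in simp)
  qed
next
  have "joint_count_sets l \<subseteq> sets (labeled_point_sets l :: ((real ^ 'd) set \<times> _) measure)"
    unfolding joint_count_sets_def using sets_joint_count_set by blast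
  from sets.sigma_sets_subset[OF this]
  show "sigma_sets {(S, \<phi>). finite S \<and> \<phi> \<in> label_functions l S} (joint_count_sets l)
    \<subseteq> sets (labeled_point_sets l :: ((real ^ 'd) set \<times> _) measure)"
    by (simp add: space_labeled_point_sets)
qed

section \<open>Measurability of the number of consistent labelings\<close>

text \<open>Equally large fibres are matched one by one and the matchings are glued. The glued map
  preserves \<open>f\<close>, so points from different fibres keep different images.\<close>

lemma ex_bij_betw_fibres:
  assumes "finite S" "finite S'"
    and "\<And>t. card {x \<in> S. f x = t} = card {x \<in> S'. f x = t}"
  shows "\<exists>h. bij_betw h S S' \<and> (\<forall>x\<in>S. f (h x) = f x)"
proof -
  have "\<exists>h. bij_betw h {x \<in> S. f x = t} {x \<in> S'. f x = t}" for t
    using assms by (intro finite_same_card_bij) auto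
  then obtain h where h: "bij_betw (h t) {x \<in> S. f x = t} {x \<in> S'. f x = t}" for t
    by metis
  let ?k = "\<lambda>x. h (f x) x"
  have k: "?k x \<in> S' \<and> f (?k x) = f x" if "x \<in> S" for x
    using bij_betwE[OF h[of "f x"]] that by auto
  have "inj_on ?k S"
  proof (rule inj_onI)
    fix x y assume xy: "x \<in> S" "y \<in> S" "?k x = ?k y"
    then have "f x = f y"
      using k by metis
    then show "x = y"
      using inj_onD[OF bij_betw_imp_inj_on[OF h[of "f x"]], of x y] xy by auto
  qed
  moreover have "S' \<subseteq> ?k ` S"
  proof
    fix y assume "y \<in> S'"
    then have "y \<in> h (f y) ` {x \<in> S. f x = f y}"
      by (simp add: bij_betw_imp_surj_on[OF h])
    then obtain x where "x \<in> S" "f x = f y" "y = h (f y) x"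
      by blast
    then show "y \<in> ?k ` S"
      by (intro image_eqI[of _ _ x]) auto
  qed
  ultimately show ?thesis
    using k by (intro exI[of _ ?k]) (auto simp: bij_betw_def)
qed

text \<open>Labelings of \<open>S'\<close> are pulled back to \<open>S\<close> along a bijection
  that preserves membership in every set occurring in \<open>I\<close>. The hypothesis on the
  cardinalities is symmetric in \<open>S\<close> and \<open>S'\<close>, so this one inequality will
  yield equality.\<close>

lemma card_consistent_labels_le:
  assumes "finite S" "finite S'"
    and card: "\<And>T. card {x \<in> S. {B \<in> fst ` I. x \<in> B} = T} = card {x \<in> S'. {B \<in> fst ` I. x \<in> B} = T}"
  shows "card (consistent_labels l I S') \<le> card (consistent_labels l I S)"
proof -
  obtain h where h: "bij_betw h S S'" "\<And>x. x \<in> S \<Longrightarrow> {B \<in> fst ` I. h x \<in> B} = {B \<in> fst ` I. x \<in> B}"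
    using ex_bij_betw_fibres[OF assms] by auto
  have mem: "h x \<in> B \<longleftrightarrow> x \<in> B" if "x \<in> S" "B \<in> fst ` I" for x B
    using h(2)[OF that(1)] that(2) by blast
  have inj: "inj_on h S" and im: "h ` S = S'"
    using h(1) by (auto simp: bij_betw_def)
  \<comment> \<open>The restriction to \<open>S\<close> makes the pulled-back labeling extensional,
    as \<open>label_functions\<close> requires.\<close>
  let ?F = "\<lambda>\<phi>. \<lambda>x\<in>S. \<phi> (h x)"
  show ?thesis
  proof (rule card_inj_on_le)
    show "inj_on ?F (consistent_labels l I S')"
    proof (rule inj_onI)
      fix \<phi> \<psi> assume *: "\<phi> \<in> consistent_labels l I S'" "\<psi> \<in> consistent_labels l I S'" "?F \<phi> = ?F \<psi>"
      have "\<phi> (h x) = \<psi> (h x)" if "x \<in> S" for x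
        using fun_cong[OF *(3), of x] that by simp
      then have "\<phi> y = \<psi> y" if "y \<in> S'" for y
        using that im by auto
      moreover have "\<phi> \<in> S' \<rightarrow>\<^sub>E {1..l}" "\<psi> \<in> S' \<rightarrow>\<^sub>E {1..l}"
        using *(1,2) by (simp_all add: consistent_labels_def label_functions_def)
      ultimately show "\<phi> = \<psi>"
        by (intro PiE_ext)
    qed
    show "?F ` consistent_labels l I S' \<subseteq> consistent_labels l I S"
    proof (rule image_subsetI)
      fix \<phi> assume \<phi>: "\<phi> \<in> consistent_labels l I S'"
      have "?F \<phi> \<in> label_functions l S"
        using \<phi> im by (auto simp: consistent_labels_def label_functions_def PiE_def Pi_def)
      moreover have "card {x \<in> S \<inter> B. ?F \<phi> x = y} \<in> A" if i: "(B, A, y) \<in> I" for B A y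
      proof -
        have "B \<in> fst ` I"
          using i by force
        then have "{x \<in> S' \<inter> B. \<phi> x = y} = h ` {x \<in> S \<inter> B. ?F \<phi> x = y}"
          unfolding im[symmetric] using mem by auto
        then have "card {x \<in> S' \<inter> B. \<phi> x = y} = card {x \<in> S \<inter> B. ?F \<phi> x = y}"
          using inj by (auto intro!: card_image intro: inj_on_subset)
        moreover have "card {x \<in> S' \<inter> B. \<phi> x = y} \<in> A"
          using \<phi> i by (auto simp: consistent_labels_def)
        ultimately show ?thesis
          by argo
      qed
      ultimately show "?F \<phi> \<in> consistent_labels l I S"
        unfolding consistent_labels_def by blast
    qed
    show "finite (consistent_labels l I S)"
      using finite_label_functions[OF assms(1)] by (simp add: consistent_labels_def)
  qed
qed

text \<open>The number depends on \<open>S\<close> only through its point counts in the finitely many atoms of the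
  algebra generated by the sets occurring in \<open>I\<close>, since a bijection between two point sets that
  preserves the atoms carries consistent labels to consistent labels.\<close>

lemma measurable_card_consistent_labels:
  assumes "finite I" "fst ` I \<subseteq> sets borel"
  shows "(\<lambda>S. card (consistent_labels l I S)) \<in>
    (point_sets :: (real ^ 'd) set measure) \<rightarrow>\<^sub>M count_space UNIV"
proof -
  define atom where "atom T = {x. {B \<in> fst ` I. x \<in> B} = T}" for T :: "(real ^ 'd) set set"
  obtain Ts where Ts: "set Ts = Pow (fst ` I)"
    using assms(1) finite_list[of "Pow (fst ` I)"] by auto
  \<comment> \<open>The counts in all atoms form a list of naturals, treated as a value in a
    discrete space, so that any function of \<open>k S\<close> is measurable once \<open>k\<close>
    is.\<close>
  define k where "k S = map (\<lambda>T. card (S \<inter> atom T)) Ts" for S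
  have atom_borel: "atom T \<in> sets borel" for T
  proof (cases "T \<subseteq> fst ` I")
    case True
    then have "atom T = {x \<in> space borel. \<forall>B\<in>fst ` I. x \<in> B \<longleftrightarrow> B \<in> T}"
      unfolding atom_def by auto
    also have "\<dots> \<in> sets borel"
    proof (rule sets.sets_Collect_finite_All)
      fix B assume "B \<in> fst ` I"
      then have "B \<in> sets borel" using assms by auto
      then show "{x \<in> space borel. x \<in> B \<longleftrightarrow> B \<in> T} \<in> sets borel"
        by measurable
    qed (use assms in simp)
    finally show ?thesis .
  next
    case False
    then have "atom T = {}" unfolding atom_def by auto
    then show ?thesis by simp
  qed
  have k: "k \<in> point_sets \<rightarrow>\<^sub>M count_space UNIV"
    unfolding k_def
  proof (induction Ts)
    case (Cons T Ts)
    have "(\<lambda>S. card (S \<inter> atom T)) \<in> point_sets \<rightarrow>\<^sub>M count_space UNIV"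
      by (rule measurable_card_Int[OF atom_borel])
    with Cons show ?case
      by simp
  qed simp
  have le: "card (consistent_labels l I S') \<le> card (consistent_labels l I S)"
    if "finite S" "finite S'" "k S = k S'" for S S'
  proof (rule card_consistent_labels_le[OF that(1,2)])
    fix T
    have *: "{x \<in> R. {B \<in> fst ` I. x \<in> B} = T} = R \<inter> atom T" for R
      by (auto simp: atom_def)
    show "card {x \<in> S. {B \<in> fst ` I. x \<in> B} = T} = card {x \<in> S'. {B \<in> fst ` I. x \<in> B} = T}"
    proof (cases "T \<in> set Ts")
      case True
      then show ?thesis
        using that(3) unfolding * k_def by simp
    next
      case False
      then have "atom T = {}" unfolding Ts atom_def by auto
      then show ?thesis unfolding * by simp
    qed
  qed
  \<comment> \<open>\<open>G\<close> evaluates the number on a chosen point set with count vector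
    \<open>w\<close>; its value at unattained \<open>w\<close> is arbitrary. By \<open>le\<close> in
    both directions, the choice does not affect the value at \<open>k S\<close>.\<close>
  define G where "G w = card (consistent_labels l I (SOME S. finite S \<and> k S = w))" for w
  have "card (consistent_labels l I S) = G (k S)" if "finite S" for S
  proof -
    have "finite (SOME S'. finite S' \<and> k S' = k S) \<and> k (SOME S'. finite S' \<and> k S' = k S) = k S"
      by (rule someI[where P = "\<lambda>S'. finite S' \<and> k S' = k S"]) (use that in simp)
    then show ?thesis
      unfolding G_def using le that by (intro antisym) auto
  qed
  moreover have "(\<lambda>S. G (k S)) \<in> point_sets \<rightarrow>\<^sub>M count_space UNIV"
    using k by (rule measurable_compose) simp
  ultimately show ?thesis
    by (subst measurable_cong[where g = "\<lambda>S. G (k S)"]) (auto simp: space_point_sets)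
qed

section \<open>The law of a labeled point set over a fixed point set\<close>

lemma measurable_Pair_label:
  assumes "finite S"
  shows "Pair S \<in> point_measure (label_functions l S) p \<rightarrow>\<^sub>M labeled_point_sets l"
  using assms by (auto simp: space_point_measure sets_point_measure space_labeled_point_sets intro!: measurableI)

text \<open>The law lives on the finite fibre over \<open>S\<close>, so all later computations on a
  fibre become finite sums.\<close>

lemma nn_integral_label_law:
  assumes "finite S" "f \<in> borel_measurable (labeled_point_sets l)"
  shows "(\<integral>\<^sup>+ z. f z \<partial>label_law l \<Lambda> S) =
    (\<Sum>\<phi>\<in>label_functions l S. ennreal (pmf (\<Lambda> S) \<phi>) * f (S, \<phi>))"
  unfolding label_law_def
  by (simp add: nn_integral_distr[OF measurable_Pair_label] assms
      nn_integral_point_measure_finite finite_label_functions)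

lemma sets_label_law [simp]: "sets (label_law l \<Lambda> S) = sets (labeled_point_sets l)"
  by (simp add: label_law_def)

lemma space_label_law [simp]: "space (label_law l \<Lambda> S) = space (labeled_point_sets l)"
  by (simp add: label_law_def)

lemma emeasure_label_law:
  assumes "finite S" "X \<in> sets (labeled_point_sets l)"
  shows "emeasure (label_law l \<Lambda> S) X =
    (\<Sum>\<phi>\<in>label_functions l S. ennreal (pmf (\<Lambda> S) \<phi>) * indicator X (S, \<phi>))"
  using nn_integral_label_law[OF assms(1), of "indicator X" l \<Lambda>] assms(2) by simp

lemma prob_space_label_law:
  assumes "finite S" "set_pmf (\<Lambda> S) \<subseteq> label_functions l S"
  shows "prob_space (label_law l \<Lambda> S)"
proof (rule prob_spaceI)
  have "emeasure (label_law l \<Lambda> S) (space (label_law l \<Lambda> S)) =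
      (\<Sum>\<phi>\<in>label_functions l S. ennreal (pmf (\<Lambda> S) \<phi>))"
    using assms(1) by (simp add: emeasure_label_law)
      (auto simp: space_labeled_point_sets intro!: sum.cong)
  also have "\<dots> = ennreal (\<Sum>\<phi>\<in>label_functions l S. pmf (\<Lambda> S) \<phi>)"
    by simp
  also have "(\<Sum>\<phi>\<in>label_functions l S. pmf (\<Lambda> S) \<phi>) = 1"
    by (rule sum_pmf_eq_1) (use assms finite_label_functions in auto)
  finally show "emeasure (label_law l \<Lambda> S) (space (label_law l \<Lambda> S)) = 1"
    by simp
qed

section \<open>The uniform labeling as reference kernel\<close>

definition uniform_labeling :: "nat \<Rightarrow> 'a set \<Rightarrow> ('a \<Rightarrow> nat) pmf" where
  "uniform_labeling l S = pmf_of_set (label_functions l S)"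

lemma set_pmf_uniform_labeling:
  "1 \<le> l \<Longrightarrow> finite S \<Longrightarrow> set_pmf (uniform_labeling l S) = label_functions l S"
  by (simp add: uniform_labeling_def label_functions_nonempty finite_label_functions)

text \<open>On a joint count set the uniform law is a quotient of two numbers of consistent
  labelings, each a measurable function of the point set.\<close>

lemma measurable_label_law_uniform:
  assumes l: "1 \<le> l"
  shows "label_law l (uniform_labeling l) \<in>
    (point_sets :: (real ^ 'd) set measure) \<rightarrow>\<^sub>M prob_algebra (labeled_point_sets l)"
proof (rule measurable_prob_algebra_generated[OF sets_labeled_point_sets_joint Int_stable_joint_count_sets])
  show "joint_count_sets l \<subseteq>
    Pow {(S :: (real ^ 'd) set, \<phi>). finite S \<and> \<phi> \<in> label_functions l S}"
    unfolding joint_count_sets_def joint_count_set_def consistent_labels_def by auto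
next
  fix S :: "(real ^ 'd) set"
  assume "S \<in> space point_sets"
  then show "prob_space (label_law l (uniform_labeling l) S)"
    using l by (intro prob_space_label_law) (auto simp: space_point_sets set_pmf_uniform_labeling)
next
  fix a :: "((real ^ 'd) set \<times> (real ^ 'd \<Rightarrow> nat)) set"
  assume a: "a \<in> joint_count_sets l"
  then obtain I where I: "finite I" "I \<subseteq> sets borel \<times> UNIV \<times> {1..l}" "a = joint_count_set l I"
    unfolding joint_count_sets_def by (elim imageE CollectE conjE)
  have a_sets: "a \<in> sets (labeled_point_sets l)"
    unfolding sets_labeled_point_sets_joint using a by (rule sigma_sets.Basic)
  \<comment> \<open>The number of all label functions is written as
    \<open>consistent_labels l {} S\<close>, so that the measurability of numerator and denominator
    comes from the same lemma.\<close>
  have eq: "emeasure (label_law l (uniform_labeling l) S) a =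
      ennreal (real (card (consistent_labels l I S)) / real (card (consistent_labels l {} S)))"
    if S: "finite S" for S
  proof -
    have "emeasure (label_law l (uniform_labeling l) S) a =
       (\<Sum>\<phi>\<in>label_functions l S. ennreal (indicator (consistent_labels l I S) \<phi> / card (label_functions l S)))"
      unfolding emeasure_label_law[OF S a_sets]
      using S l by (intro sum.cong refl)
        (auto simp: uniform_labeling_def label_functions_nonempty finite_label_functions
           I(3) joint_count_set_def split: split_indicator)
    also have "\<dots> = ennreal (\<Sum>\<phi>\<in>label_functions l S. indicator (consistent_labels l I S) \<phi> / card (label_functions l S))"
      by (rule sum_ennreal) simp
    also have "(\<Sum>\<phi>\<in>label_functions l S. indicator (consistent_labels l I S) \<phi> / card (label_functions l S))
        = real (card (label_functions l S \<inter> consistent_labels l I S)) / card (label_functions l S)"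
      using S by (simp add: sum_divide_distrib[symmetric] indicator_def sum_of_bool_eq finite_label_functions)
    also have "label_functions l S \<inter> consistent_labels l I S = consistent_labels l I S"
      by (auto simp: consistent_labels_def)
    finally show ?thesis
      by (simp add: consistent_labels_def)
  qed
  have [measurable]:
      "(\<lambda>S. card (consistent_labels l I S)) \<in> (point_sets :: (real ^ 'd) set measure) \<rightarrow>\<^sub>M count_space UNIV"
      "(\<lambda>S. card (consistent_labels l {} S)) \<in> (point_sets :: (real ^ 'd) set measure) \<rightarrow>\<^sub>M count_space UNIV"
    using I by (auto intro!: measurable_card_consistent_labels)
  have "(\<lambda>S. ennreal (real (card (consistent_labels l I S)) / real (card (consistent_labels l {} S))))
      \<in> borel_measurable (point_sets :: (real ^ 'd) set measure)"
    by measurable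
  then show "(\<lambda>S. emeasure (label_law l (uniform_labeling l) S) a) \<in> borel_measurable point_sets"
    by (subst measurable_cong[OF eq]) (auto simp: space_point_sets)
qed simp

section \<open>Reweighting a kernel by a density\<close>

text \<open>Translates a pointwise reweighting of mass functions into a density on pairs, so that
  measurability of the new kernel can be derived from that of the old one.\<close>

lemma label_law_eq_density:
  fixes S :: "(real ^ 'd) set"
  assumes S: "finite S" and f[measurable]: "f \<in> borel_measurable (labeled_point_sets l)"
    and \<Lambda>': "\<And>\<phi>. \<phi> \<in> label_functions l S \<Longrightarrow>
      ennreal (pmf (\<Lambda>' S) \<phi>) = f (S, \<phi>) * ennreal (pmf (\<Lambda> S) \<phi>)"
  shows "label_law l \<Lambda>' S = density (label_law l \<Lambda> S) f"
proof (rule measure_eqI)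
  fix X assume "X \<in> sets (label_law l \<Lambda>' S)"
  then have X[measurable]: "X \<in> sets (labeled_point_sets l)"
    by simp
  have "emeasure (density (label_law l \<Lambda> S) f) X = (\<integral>\<^sup>+ z. f z * indicator X z \<partial>label_law l \<Lambda> S)"
    by (rule emeasure_density) (simp_all cong: measurable_cong_sets)
  also have "\<dots> = (\<Sum>\<phi>\<in>label_functions l S. ennreal (pmf (\<Lambda> S) \<phi>) * (f (S, \<phi>) * indicator X (S, \<phi>)))"
    by (rule nn_integral_label_law[OF S]) measurable
  also have "\<dots> = emeasure (label_law l \<Lambda>' S) X"
    unfolding emeasure_label_law[OF S X] by (intro sum.cong refl) (simp add: \<Lambda>' mult_ac)
  finally show "emeasure (label_law l \<Lambda>' S) X = emeasure (density (label_law l \<Lambda> S) f) X" ..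
qed simp

text \<open>The mass of \<open>A\<close> under the reweighted kernel is the integral of
  \<open>f\<close> times the indicator of \<open>A\<close> against \<open>K x\<close>, and integrals
  against a kernel depend measurably on \<open>x\<close>. The normalization keeps each measure a
  probability measure.\<close>

lemma measurable_density_prob_algebra:
  assumes K: "K \<in> M \<rightarrow>\<^sub>M prob_algebra N" and f[measurable]: "f \<in> borel_measurable N"
    and one: "\<And>x. x \<in> space M \<Longrightarrow> (\<integral>\<^sup>+ z. f z \<partial>K x) = 1"
  shows "(\<lambda>x. density (K x) f) \<in> M \<rightarrow>\<^sub>M prob_algebra N"
proof -
  have K': "K \<in> M \<rightarrow>\<^sub>M subprob_algebra N"
    using K by (rule measurable_prob_algebraD)
  have sets: "sets (K x) = sets N" if "x \<in> space M" for x
    using sets_kernel[OF K' that] .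
  have prob: "prob_space (density (K x) f)" if "x \<in> space M" for x
  proof (rule prob_spaceI)
    have "f \<in> borel_measurable (K x)"
      using f sets[OF that] by (simp cong: measurable_cong_sets)
    then have "emeasure (density (K x) f) (space (density (K x) f)) =
        (\<integral>\<^sup>+ z. f z * indicator (space (K x)) z \<partial>K x)"
      by (simp add: emeasure_density)
    also have "\<dots> = (\<integral>\<^sup>+ z. f z \<partial>K x)"
      by (rule nn_integral_cong) simp
    finally show "emeasure (density (K x) f) (space (density (K x) f)) = 1"
      using one[OF that] by simp
  qed
  show ?thesis
  proof (rule measurable_prob_algebraI[OF prob], assumption, rule measurable_subprob_algebra)
    fix A assume A[measurable]: "A \<in> sets N"
    have "(\<lambda>x. \<integral>\<^sup>+ z. f z * indicator A z \<partial>K x) \<in> borel_measurable M"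
      by (rule measurable_compose[OF K' nn_integral_measurable_subprob_algebra]) measurable
    moreover have "emeasure (density (K x) f) A = (\<integral>\<^sup>+ z. f z * indicator A z \<partial>K x)"
      if "x \<in> space M" for x
      by (rule emeasure_density) (use f A sets[OF that] in \<open>simp_all cong: measurable_cong_sets\<close>)
    ultimately show "(\<lambda>x. emeasure (density (K x) f) A) \<in> borel_measurable M"
      by (simp cong: measurable_cong)
  qed (use prob sets in \<open>auto intro: prob_space_imp_subprob_space\<close>)
qed

section \<open>Disintegration along the projection to the point set\<close>

text \<open>Every fibre of the projection is finite and charged at each of its points by the uniform
  labeling, so a null set of the uniformly labeled law misses almost every fibre completely.\<close>

lemma absolutely_continuous_uniform_labeling:
  fixes Q :: "((real ^ 'd) set \<times> (real ^ 'd \<Rightarrow> nat)) measure"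
  assumes l: "1 \<le> l" and Q: "Q \<in> space (prob_algebra (labeled_point_sets l))"
  shows "absolutely_continuous (distr Q point_sets fst \<bind> label_law l (uniform_labeling l)) Q"
proof -
  let ?M = "distr Q point_sets fst" and ?u = "label_law l (uniform_labeling l)"
  have setsQ[measurable_cong]: "sets Q = sets (labeled_point_sets l)" and "prob_space Q"
    using Q by (auto simp: space_prob_algebra)
  have spaceQ: "space Q = space (labeled_point_sets l)"
    by (rule sets_eq_imp_space_eq[OF setsQ])
  have fst: "fst \<in> Q \<rightarrow>\<^sub>M (point_sets :: (real ^ 'd) set measure)"
    using measurable_fst_labeled_point_sets by (simp add: measurable_cong_sets[OF setsQ refl])
  interpret M: prob_space ?M
    by (rule prob_space.prob_space_distr[OF \<open>prob_space Q\<close> fst])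
  have u: "?u \<in> (point_sets :: (real ^ 'd) set measure) \<rightarrow>\<^sub>M prob_algebra (labeled_point_sets l)"
    by (rule measurable_label_law_uniform[OF l])
  have M: "?M \<in> space (prob_algebra point_sets)"
    using M.prob_space_axioms by (simp add: space_prob_algebra)
  show ?thesis
    unfolding absolutely_continuous_def
  proof
    fix N assume "N \<in> null_sets (?M \<bind> ?u)"
    then have N: "N \<in> sets (labeled_point_sets l)" and null: "emeasure (?M \<bind> ?u) N = 0"
      by (auto simp: null_sets_def sets_bind'[OF M u])
    have meas: "(\<lambda>S. emeasure (?u S) N) \<in> borel_measurable (point_sets :: (real ^ 'd) set measure)"
      by (rule measurable_compose[OF measurable_prob_algebraD[OF u] measurable_emeasure_subprob_algebra[OF N]])
    have "(\<integral>\<^sup>+ S. emeasure (?u S) N \<partial>?M) = 0"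
      using null by (simp add: emeasure_bind_prob_algebra[OF M u N])
    then have "AE S in ?M. emeasure (?u S) N = 0"
      by (subst (asm) nn_integral_0_iff_AE) (use meas in simp_all)
    \<comment> \<open>\<open>?M\<close> is the point set marginal of \<open>Q\<close>, so its null
      sets pull back to null sets of \<open>Q\<close>.\<close>
    then have AE: "AE z in Q. emeasure (?u (fst z)) N = 0"
      by (rule AE_distrD[OF fst])
    have "AE z in Q. z \<notin> N"
      using AE
    proof (rule AE_mp, intro AE_I2 impI notI)
      fix z assume z: "z \<in> space Q" "emeasure (?u (fst z)) N = 0" "z \<in> N"
      have S: "finite (fst z)" "snd z \<in> label_functions l (fst z)"
        using z(1) by (auto simp: spaceQ space_labeled_point_sets)
      \<comment> \<open>A vanishing finite sum of nonnegative terms vanishes termwise, in particular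
        at the label function of \<open>z\<close> itself, which the uniform labeling
        charges.\<close>
      have "\<forall>\<phi>\<in>label_functions l (fst z).
          ennreal (pmf (uniform_labeling l (fst z)) \<phi>) * indicator N (fst z, \<phi>) = 0"
        using z(2) unfolding emeasure_label_law[OF S(1) N]
        by (subst (asm) sum_eq_0_iff) (simp_all add: finite_label_functions[OF S(1)])
      from bspec[OF this S(2)] have "ennreal (pmf (uniform_labeling l (fst z)) (snd z)) = 0"
        using z(3) by simp
      then have "snd z \<notin> set_pmf (uniform_labeling l (fst z))"
        by (simp add: set_pmf_iff)
      then show False
        using S l by (simp add: set_pmf_uniform_labeling)
    qed
    then show "N \<in> null_sets Q"
      using N by (subst (asm) AE_iff_null_sets[symmetric]) (simp_all add: setsQ)
  qed
qed

text \<open>Finiteness of the fibres takes the place of the topological assumptions usual for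
  disintegrations: a Radon-Nikodym derivative against the uniformly labeled law already yields
  conditional mass functions.\<close>

lemma ex_labeling_disintegration:
  fixes Q :: "((real ^ 'd) set \<times> (real ^ 'd \<Rightarrow> nat)) measure"
  assumes l: "1 \<le> l" and Q: "Q \<in> space (prob_algebra (labeled_point_sets l))"
  shows "\<exists>\<Lambda>. random_labeling l \<Lambda> \<and> distr Q point_sets fst \<bind> label_law l \<Lambda> = Q"
proof -
  define M :: "(real ^ 'd) set measure" where "M = distr Q point_sets fst"
  let ?u = "label_law l (uniform_labeling l)"
  have setsQ[measurable_cong]: "sets Q = sets (labeled_point_sets l)" and "prob_space Q"
    using Q by (auto simp: space_prob_algebra)
  have fst_lps[measurable]: "fst \<in> labeled_point_sets l \<rightarrow>\<^sub>M (point_sets :: (real ^ 'd) set measure)"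
    by (rule measurable_fst_labeled_point_sets)
  have fst: "fst \<in> Q \<rightarrow>\<^sub>M (point_sets :: (real ^ 'd) set measure)"
    by measurable
  have setsM[measurable_cong, simp]: "sets M = sets point_sets"
    by (simp add: M_def)
  have spaceM[simp]: "space M = {S. finite S}"
    by (simp add: M_def space_point_sets)
  interpret M: prob_space M
    unfolding M_def by (rule prob_space.prob_space_distr[OF \<open>prob_space Q\<close> fst])
  have M: "M \<in> space (prob_algebra point_sets)"
    using M.prob_space_axioms by (simp add: space_prob_algebra)
  have u: "?u \<in> (point_sets :: (real ^ 'd) set measure) \<rightarrow>\<^sub>M prob_algebra (labeled_point_sets l)"
    by (rule measurable_label_law_uniform[OF l])
  have u': "?u \<in> (point_sets :: (real ^ 'd) set measure) \<rightarrow>\<^sub>M subprob_algebra (labeled_point_sets l)"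
    using u by (rule measurable_prob_algebraD)
  have uM: "?u \<in> M \<rightarrow>\<^sub>M subprob_algebra (labeled_point_sets l)"
    using u' by (simp cong: measurable_cong_sets)
  define U where "U = M \<bind> ?u"
  have setsU[measurable_cong]: "sets U = sets (labeled_point_sets l)"
    unfolding U_def by (rule sets_bind'[OF M u])
  interpret U: prob_space U
    unfolding U_def by (rule prob_space_bind'[OF M u])
  have ac: "absolutely_continuous U Q"
    unfolding U_def M_def by (rule absolutely_continuous_uniform_labeling[OF l Q])
  obtain f where "f \<in> borel_measurable U" and fQ: "density U f = Q"
    using U.Radon_Nikodym[OF ac] by (auto simp: setsQ setsU)
  then have f[measurable]: "f \<in> borel_measurable (labeled_point_sets l)"
    by measurable
  \<comment> \<open>The total mass over \<open>S\<close> after reweighting the uniform labeling by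
    \<open>f\<close>; it has to be 1 for the result to be a labeling.\<close>
  define w where "w S = (\<integral>\<^sup>+ z. f z \<partial>?u S)" for S
  have w[measurable]: "w \<in> borel_measurable point_sets"
    unfolding w_def by (rule measurable_compose[OF u' nn_integral_measurable_subprob_algebra]) measurable
  \<comment> \<open>\<open>U\<close> and \<open>Q = density U f\<close> both have point set marginal
    \<open>M\<close>. Integrating \<open>f\<close> over the fibres therefore shows that
    \<open>w\<close> is a density of \<open>M\<close> with respect to itself, and uniqueness of
    densities gives \<open>w = 1\<close> almost everywhere.\<close>
  have "density M w = density M (\<lambda>_. 1)"
  proof (rule measure_eqI)
    fix A assume "A \<in> sets (density M w)"
    then have A[measurable]: "A \<in> sets point_sets"
      by simp
    have "emeasure (density M w) A = (\<integral>\<^sup>+ S. w S * indicator A S \<partial>M)"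
      by (rule emeasure_density) measurable
    also have "\<dots> = (\<integral>\<^sup>+ S. (\<integral>\<^sup>+ z. f z * indicator A (fst z) \<partial>?u S) \<partial>M)"
    proof (rule nn_integral_cong)
      fix S assume "S \<in> space M"
      then have S: "finite S" by simp
      show "w S * indicator A S = (\<integral>\<^sup>+ z. f z * indicator A (fst z) \<partial>?u S)"
        unfolding w_def by (subst (1 2) nn_integral_label_law[OF S])
          (simp_all add: sum_distrib_right mult.assoc)
    qed
    also have "\<dots> = (\<integral>\<^sup>+ z. f z * indicator A (fst z) \<partial>U)"
      unfolding U_def by (rule nn_integral_bind[symmetric, OF _ uM]) measurable
    also have "\<dots> = (\<integral>\<^sup>+ z. indicator A (fst z) \<partial>density U f)"
      by (rule nn_integral_density[symmetric]) measurable
    also have "\<dots> = (\<integral>\<^sup>+ S. indicator A S \<partial>M)"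
      unfolding fQ M_def by (rule nn_integral_distr[symmetric, OF fst]) measurable
    finally show "emeasure (density M w) A = emeasure (density M (\<lambda>_. 1)) A"
      by (simp add: density_1)
  qed simp
  moreover have "w \<in> borel_measurable M"
    by measurable
  ultimately have w_one: "AE S in M. w S = 1"
    by (subst (asm) M.density_unique_iff) simp_all
  \<comment> \<open>The value 1 on badly normalized fibres selects the uniform labeling there. This
    gives total mass 1 for every finite \<open>S\<close>, as \<open>random_labeling\<close> demands,
    and not only for almost every one.\<close>
  define f' where "f' z = (if w (fst z) = 1 then f z else 1)" for z
  have f'[measurable]: "f' \<in> borel_measurable (labeled_point_sets l)"
    unfolding f'_def by measurable
  have f'_sum: "(\<Sum>\<phi>\<in>label_functions l S. ennreal (pmf (uniform_labeling l S) \<phi>) * f' (S, \<phi>)) = 1"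
    if S: "finite S" for S
  proof (cases "w S = 1")
    case True
    then show ?thesis
      using nn_integral_label_law[OF S f, of "uniform_labeling l"] by (simp add: w_def[symmetric] f'_def)
  next
    case False
    have "(\<Sum>\<phi>\<in>label_functions l S. pmf (uniform_labeling l S) \<phi>) = 1"
      using S l by (intro sum_pmf_eq_1) (simp_all add: finite_label_functions set_pmf_uniform_labeling)
    with False show ?thesis
      by (simp add: f'_def)
  qed
  define p where "p S \<phi> = enn2real (if \<phi> \<in> label_functions l S
      then f' (S, \<phi>) * ennreal (pmf (uniform_labeling l S) \<phi>) else 0)" for S \<phi>
  define \<Lambda> where "\<Lambda> S = embed_pmf (p S)" for S
  have ennreal_p: "ennreal (p S \<phi>) = f' (S, \<phi>) * ennreal (pmf (uniform_labeling l S) \<phi>)"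
    if "finite S" "\<phi> \<in> label_functions l S" for S \<phi>
  proof -
    have "f' (S, \<phi>) * ennreal (pmf (uniform_labeling l S) \<phi>) \<le> 1"
      unfolding f'_sum[OF that(1), symmetric]
      using that member_le_sum[of \<phi> "label_functions l S"
          "\<lambda>\<phi>. ennreal (pmf (uniform_labeling l S) \<phi>) * f' (S, \<phi>)"]
      by (simp add: finite_label_functions mult.commute)
    then show ?thesis
      using that by (auto simp: p_def intro!: ennreal_enn2real le_less_trans[OF _ ennreal_one_less_top])
  qed
  have pmf_\<Lambda>: "pmf (\<Lambda> S) \<phi> = p S \<phi>" if S: "finite S" for S \<phi>
    unfolding \<Lambda>_def
  proof (rule pmf_embed_pmf)
    have "(\<integral>\<^sup>+ \<phi>. ennreal (p S \<phi>) \<partial>count_space UNIV) = (\<Sum>\<phi>\<in>label_functions l S. ennreal (p S \<phi>))"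
      using finite_label_functions[OF S]
      by (intro nn_integral_count_space'[OF _ _ subset_UNIV]) (auto simp: p_def)
    also have "\<dots> = 1"
      unfolding f'_sum[OF S, symmetric] using S by (intro sum.cong refl) (simp add: ennreal_p mult.commute)
    finally show "(\<integral>\<^sup>+ \<phi>. ennreal (p S \<phi>) \<partial>count_space UNIV) = 1" .
  qed (simp add: p_def)
  have law: "label_law l \<Lambda> S = density (?u S) f'" if "finite S" for S
    by (rule label_law_eq_density) (use that in \<open>simp_all add: pmf_\<Lambda> ennreal_p\<close>)
  have "set_pmf (\<Lambda> S) \<subseteq> label_functions l S" if S: "finite S" for S
    using pmf_\<Lambda>[OF S] by (auto simp: set_pmf_iff p_def split: if_splits)
  moreover have kernel: "label_law l \<Lambda> \<in> point_sets \<rightarrow>\<^sub>M prob_algebra (labeled_point_sets l)"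
  proof -
    have "(\<lambda>S. density (?u S) f') \<in> point_sets \<rightarrow>\<^sub>M prob_algebra (labeled_point_sets l)"
      by (rule measurable_density_prob_algebra[OF u f'])
        (simp add: space_point_sets nn_integral_label_law[OF _ f'] f'_sum)
    then show ?thesis
      by (subst measurable_cong[OF law]) (simp_all add: space_point_sets)
  qed
  ultimately have "random_labeling l \<Lambda>"
    by (simp add: random_labeling_def)
  moreover have "M \<bind> label_law l \<Lambda> = Q"
  proof (rule measure_eqI)
    show "sets (M \<bind> label_law l \<Lambda>) = sets Q"
      unfolding setsQ by (rule sets_bind'[OF M kernel])
    fix X assume "X \<in> sets (M \<bind> label_law l \<Lambda>)"
    then have X[measurable]: "X \<in> sets (labeled_point_sets l)"
      by (simp add: sets_bind'[OF M kernel])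
    have "emeasure (M \<bind> label_law l \<Lambda>) X = (\<integral>\<^sup>+ S. emeasure (label_law l \<Lambda> S) X \<partial>M)"
      by (rule emeasure_bind_prob_algebra[OF M kernel X])
    \<comment> \<open>\<open>f'\<close> and \<open>f\<close> agree on every fibre with
      \<open>w S = 1\<close>, so the correction disappears under the integral over
      \<open>M\<close>.\<close>
    also have "\<dots> = (\<integral>\<^sup>+ S. (\<integral>\<^sup>+ z. f z * indicator X z \<partial>?u S) \<partial>M)"
    proof (rule nn_integral_cong_AE, use w_one in \<open>rule AE_mp\<close>, intro AE_I2 impI)
      fix S assume "S \<in> space M" and w1: "w S = 1"
      then have S: "finite S" by simp
      have "emeasure (label_law l \<Lambda> S) X = (\<integral>\<^sup>+ z. f' z * indicator X z \<partial>?u S)"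
        unfolding law[OF S] by (rule emeasure_density) (simp_all cong: measurable_cong_sets)
      also have "\<dots> = (\<integral>\<^sup>+ z. f z * indicator X z \<partial>?u S)"
        by (subst (1 2) nn_integral_label_law[OF S]) (simp_all add: f'_def w1)
      finally show "emeasure (label_law l \<Lambda> S) X = (\<integral>\<^sup>+ z. f z * indicator X z \<partial>?u S)" .
    qed
    also have "\<dots> = (\<integral>\<^sup>+ z. f z * indicator X z \<partial>U)"
      unfolding U_def by (rule nn_integral_bind[symmetric, OF _ uM]) measurable
    also have "\<dots> = emeasure Q X"
      unfolding fQ[symmetric] by (rule emeasure_density[symmetric]) measurable
    finally show "emeasure (M \<bind> label_law l \<Lambda>) X = emeasure Q X" .
  qed
  ultimately show ?thesis
    unfolding M_def by blast
qed

section \<open>Iterated integrals of real-valued functions over a mixture\<close>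

lemma integrable_bindI:
  fixes g :: "'b \<Rightarrow> real"
  assumes K: "K \<in> M \<rightarrow>\<^sub>M subprob_algebra N" and M: "space M \<noteq> {}"
    and g[measurable]: "g \<in> borel_measurable N"
    and fin: "(\<integral>\<^sup>+ x. (\<integral>\<^sup>+ z. ennreal \<bar>g z\<bar> \<partial>K x) \<partial>M) < \<infinity>"
  shows "integrable (M \<bind> K) g"
proof (rule integrableI_bounded)
  show "g \<in> borel_measurable (M \<bind> K)"
    using g by (simp add: sets_bind_measurable[OF K M] cong: measurable_cong_sets)
  show "(\<integral>\<^sup>+ z. ennreal (norm (g z)) \<partial>(M \<bind> K)) < \<infinity>"
    using fin by (subst nn_integral_bind[OF _ K]) auto
qed

text \<open>The formula for nonnegative functions is applied to the positive and the negative part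
  of \<open>g\<close>. The finite bound makes both parts finite and \<open>g\<close> integrable
  under \<open>K x\<close> for almost every \<open>x\<close>; the default value 0 of the inner
  integral at the remaining \<open>x\<close> is invisible to the outer one.\<close>

lemma integral_bind_integrable:
  fixes g :: "'b \<Rightarrow> real"
  assumes K: "K \<in> M \<rightarrow>\<^sub>M subprob_algebra N" and M: "space M \<noteq> {}"
    and g[measurable]: "g \<in> borel_measurable N"
    and fin: "(\<integral>\<^sup>+ x. (\<integral>\<^sup>+ z. ennreal \<bar>g z\<bar> \<partial>K x) \<partial>M) < \<infinity>"
  shows "(\<integral>x. (\<integral>z. g z \<partial>K x) \<partial>M) = (\<integral>z. g z \<partial>(M \<bind> K))"
proof -
  have meas: "(\<lambda>x. \<integral>\<^sup>+ z. h z \<partial>K x) \<in> borel_measurable M" if "h \<in> borel_measurable N" for h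
    by (rule measurable_compose[OF K nn_integral_measurable_subprob_algebra[OF that]])
  have gK: "g \<in> borel_measurable (K x)" if "x \<in> space M" for x
    using g sets_kernel[OF K that] by (simp cong: measurable_cong_sets)
  \<comment> \<open>\<open>ennreal\<close> truncates negative values to 0, so \<open>h = g\<close>
    and \<open>h = - g\<close> yield the integrals of the positive and negative parts. Infinite
    integrals are sent to 0, which happens only on a null set for these two
    \<open>h\<close>.\<close>
  let ?I = "\<lambda>h x. enn2real (\<integral>\<^sup>+ z. ennreal (h z) \<partial>K x)"
  have part: "integrable M (?I h) \<and> (\<integral>x. ?I h x \<partial>M) = enn2real (\<integral>\<^sup>+ z. ennreal (h z) \<partial>(M \<bind> K))"
    if h[measurable]: "h \<in> borel_measurable N" and le: "\<And>z. h z \<le> \<bar>g z\<bar>" for h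
  proof -
    have fin_h: "(\<integral>\<^sup>+ x. (\<integral>\<^sup>+ z. ennreal (h z) \<partial>K x) \<partial>M) < \<infinity>"
      by (rule le_less_trans[OF _ fin]) (intro nn_integral_mono ennreal_leI le)
    have "AE x in M. (\<integral>\<^sup>+ z. ennreal (h z) \<partial>K x) \<noteq> \<infinity>"
      by (rule nn_integral_PInf_AE) (use meas fin_h in auto)
    then have AE: "AE x in M. (\<integral>\<^sup>+ z. ennreal (h z) \<partial>K x) = ennreal (?I h x)"
      by eventually_elim (simp add: less_top)
    then have "(\<integral>\<^sup>+ x. ennreal (?I h x) \<partial>M) = (\<integral>\<^sup>+ x. (\<integral>\<^sup>+ z. ennreal (h z) \<partial>K x) \<partial>M)"
      by (intro nn_integral_cong_AE) auto
    also have "\<dots> = (\<integral>\<^sup>+ z. ennreal (h z) \<partial>(M \<bind> K))"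
      by (rule nn_integral_bind[symmetric, OF _ K]) measurable
    finally have eq: "(\<integral>\<^sup>+ x. ennreal (?I h x) \<partial>M) = (\<integral>\<^sup>+ z. ennreal (h z) \<partial>(M \<bind> K))"
      and "(\<integral>\<^sup>+ x. ennreal (?I h x) \<partial>M) < \<infinity>"
      using fin_h nn_integral_bind[OF _ K, of "\<lambda>z. ennreal (h z)"] by auto
    moreover have "?I h \<in> borel_measurable M"
      using meas[of "\<lambda>z. ennreal (h z)"] by measurable
    ultimately show ?thesis
      by (auto intro!: integrableI_nonneg simp: integral_eq_nn_integral)
  qed
  have pos: "integrable M (?I g)" "(\<integral>x. ?I g x \<partial>M) = enn2real (\<integral>\<^sup>+ z. ennreal (g z) \<partial>(M \<bind> K))"
    using part[OF g abs_ge_self] by auto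
  have "(\<lambda>z. - g z) \<in> borel_measurable N"
    by measurable
  from part[OF this abs_ge_minus_self]
  have neg: "integrable M (?I (\<lambda>z. - g z))"
      "(\<integral>x. ?I (\<lambda>z. - g z) x \<partial>M) = enn2real (\<integral>\<^sup>+ z. ennreal (- g z) \<partial>(M \<bind> K))"
    by auto
  have "AE x in M. (\<integral>\<^sup>+ z. ennreal \<bar>g z\<bar> \<partial>K x) \<noteq> \<infinity>"
    by (rule nn_integral_PInf_AE) (use meas fin in auto)
  then have "AE x in M. (\<integral>z. g z \<partial>K x) = ?I g x - ?I (\<lambda>z. - g z) x"
  proof (rule AE_mp, intro AE_I2 impI)
    fix x assume "x \<in> space M" "(\<integral>\<^sup>+ z. ennreal \<bar>g z\<bar> \<partial>K x) \<noteq> \<infinity>"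
    then have "integrable (K x) g"
      using gK by (intro integrableI_bounded) (auto simp: less_top)
    then show "(\<integral>z. g z \<partial>K x) = ?I g x - ?I (\<lambda>z. - g z) x"
      by (rule real_lebesgue_integral_def)
  qed
  then have "(\<integral>x. (\<integral>z. g z \<partial>K x) \<partial>M) = (\<integral>x. ?I g x - ?I (\<lambda>z. - g z) x \<partial>M)"
    using measurable_compose[OF K integral_measurable_subprob_algebra[OF g]]
      borel_measurable_integrable[OF pos(1)] borel_measurable_integrable[OF neg(1)]
    by (intro integral_cong_AE borel_measurable_diff)
  also have "\<dots> = (\<integral>x. ?I g x \<partial>M) - (\<integral>x. ?I (\<lambda>z. - g z) x \<partial>M)"
    using pos(1) neg(1) by (rule Bochner_Integration.integral_diff)
  also have "\<dots> = (\<integral>z. g z \<partial>(M \<bind> K))"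
    by (simp add: pos(2) neg(2) real_lebesgue_integral_def[OF integrable_bindI[OF K M g fin]])
  finally show ?thesis .
qed

section \<open>The effective labeled point process\<close>

text \<open>Supplies the condition on \<open>l\<close> under which uniform labelings exist. Without
  labels a one-point set has no label function, while a \<open>pmf\<close> always has nonempty
  support.\<close>

lemma random_labeling_labels_nonempty:
  fixes \<Lambda> :: "(real ^ 'd) set \<Rightarrow> (real ^ 'd \<Rightarrow> nat) pmf"
  assumes "random_labeling l \<Lambda>"
  shows "1 \<le> l"
proof (rule ccontr)
  assume "\<not> 1 \<le> l"
  then have "label_functions l {0 :: real ^ 'd} = {}"
    by (auto simp: label_functions_def PiE_eq_empty_iff)
  then have "set_pmf (\<Lambda> {0}) = {}"
    using assms unfolding random_labeling_def by (metis finite.emptyI finite.insertI subset_empty)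
  then show False
    by (simp add: set_pmf_not_empty)
qed

text \<open>The first equation concerns the positive part of \<open>g\<close> and holds in the
  extended nonnegative reals. The signed equation is stated under absolute integrability, since a
  Bochner integral defaults to 0 when its integrand is not integrable.\<close>

theorem theorem2:
  fixes l :: nat
    and prior :: "'t measure"
    and P :: "'t \<Rightarrow> 'w measure"
    and \<Xi> :: "'t \<Rightarrow> 'w \<Rightarrow> (real ^ 'd) set"
    and \<Lambda> :: "'t \<Rightarrow> (real ^ 'd) set \<Rightarrow> (real ^ 'd \<Rightarrow> nat) pmf"
  assumes "prob_space prior"
    and "\<And>\<theta>. \<theta> \<in> space prior \<Longrightarrow> rlpp l (P \<theta>) (\<Xi> \<theta>) (\<Lambda> \<theta>)"
    and "(\<lambda>\<theta>. rlpp_law l (P \<theta>) (\<Xi> \<theta>) (\<Lambda> \<theta>)) \<in> prior \<rightarrow>\<^sub>M prob_algebra (labeled_point_sets l)"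
  shows "\<exists>(P_eff :: (real ^ 'd) set measure) \<Xi>_eff \<Lambda>_eff.
    rlpp l P_eff \<Xi>_eff \<Lambda>_eff \<and>
    (\<forall>g :: (real ^ 'd) set \<times> (real ^ 'd \<Rightarrow> nat) \<Rightarrow> real.
      g \<in> borel_measurable (labeled_point_sets l) \<longrightarrow>
      (\<integral>\<^sup>+ \<theta>. (\<integral>\<^sup>+ z. ennreal (g z) \<partial>rlpp_law l (P \<theta>) (\<Xi> \<theta>) (\<Lambda> \<theta>)) \<partial>prior)
        = (\<integral>\<^sup>+ z. ennreal (g z) \<partial>rlpp_law l P_eff \<Xi>_eff \<Lambda>_eff) \<and>
      ((\<integral>\<^sup>+ \<theta>. (\<integral>\<^sup>+ z. ennreal \<bar>g z\<bar> \<partial>rlpp_law l (P \<theta>) (\<Xi> \<theta>) (\<Lambda> \<theta>)) \<partial>prior) < \<infinity> \<longrightarrow>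
        integrable (rlpp_law l P_eff \<Xi>_eff \<Lambda>_eff) g \<and>
        (\<integral>\<theta>. (\<integral>z. g z \<partial>rlpp_law l (P \<theta>) (\<Xi> \<theta>) (\<Lambda> \<theta>)) \<partial>prior)
          = (\<integral>z. g z \<partial>rlpp_law l P_eff \<Xi>_eff \<Lambda>_eff)))"
proof -
  let ?K = "\<lambda>\<theta>. rlpp_law l (P \<theta>) (\<Xi> \<theta>) (\<Lambda> \<theta>)"
  have nonempty: "space prior \<noteq> {}"
    using assms(1) by (rule prob_space.not_empty)
  then obtain \<theta> where "\<theta> \<in> space prior"
    by blast
  then have l: "1 \<le> l"
    using assms(2) unfolding rlpp_def by (blast intro: random_labeling_labels_nonempty)
  have prior: "prior \<in> space (prob_algebra prior)"
    using assms(1) by (simp add: space_prob_algebra)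
  have K: "?K \<in> prior \<rightarrow>\<^sub>M subprob_algebra (labeled_point_sets l)"
    using assms(3) by (rule measurable_prob_algebraD)
  \<comment> \<open>The law of a pair drawn by first drawing a state from the prior and then a
    labeled point set for that state.\<close>
  define Q where "Q = prior \<bind> ?K"
  have sets_Q: "sets Q = sets (labeled_point_sets l)" and prob_Q: "prob_space Q"
    unfolding Q_def by (rule sets_bind'[OF prior assms(3)], rule prob_space_bind'[OF prior assms(3)])
  then have "Q \<in> space (prob_algebra (labeled_point_sets l))"
    by (simp add: space_prob_algebra)
  from ex_labeling_disintegration[OF l this]
  obtain \<Lambda>_eff where \<Lambda>_eff: "random_labeling l \<Lambda>_eff"
    and Q: "distr Q point_sets fst \<bind> label_law l \<Lambda>_eff = Q"
    by blast
  \<comment> \<open>The effective point process is realized canonically: its probability space is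
    the space of point sets with the marginal of \<open>Q\<close>, and the process is the
    identity.\<close>
  let ?P = "distr Q (point_sets :: (real ^ 'd) set measure) fst"
  have "fst \<in> Q \<rightarrow>\<^sub>M (point_sets :: (real ^ 'd) set measure)"
    using measurable_fst_labeled_point_sets by (simp add: measurable_cong_sets[OF sets_Q refl])
  then have "prob_space ?P"
    by (rule prob_space.prob_space_distr[OF prob_Q])
  then have "rlpp l ?P id \<Lambda>_eff"
    using \<Lambda>_eff by (simp add: rlpp_def point_process_def id_def measurable_ident_sets)
  moreover have "rlpp_law l ?P id \<Lambda>_eff = Q"
    using Q by (simp add: rlpp_law_def id_def distr_id2)
  moreover have "(\<integral>\<^sup>+ \<theta>. (\<integral>\<^sup>+ z. ennreal (g z) \<partial>?K \<theta>) \<partial>prior) = (\<integral>\<^sup>+ z. ennreal (g z) \<partial>Q) \<and>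
      ((\<integral>\<^sup>+ \<theta>. (\<integral>\<^sup>+ z. ennreal \<bar>g z\<bar> \<partial>?K \<theta>) \<partial>prior) < \<infinity> \<longrightarrow>
        integrable Q g \<and> (\<integral>\<theta>. (\<integral>z. g z \<partial>?K \<theta>) \<partial>prior) = (\<integral>z. g z \<partial>Q))"
    if g: "g \<in> borel_measurable (labeled_point_sets l)"
    for g :: "(real ^ 'd) set \<times> (real ^ 'd \<Rightarrow> nat) \<Rightarrow> real"
    unfolding Q_def
    using nn_integral_bind[OF _ K, of "\<lambda>z. ennreal (g z)"] g
      integrable_bindI[OF K nonempty g] integral_bind_integrable[OF K nonempty g]
    by simp
  ultimately show ?thesis
    by (intro exI[of _ ?P] exI[of _ id] exI[of _ \<Lambda>_eff]) simp
qed

end
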